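(* Let $n\ge 4$ and let $(x_1,y_1),\dots,(x_n,y_n)$ be data points with $x_i,y_i>0$ for all $i$, and such that for all $i\neq j$, $(x_i,y_i)\neq(x_j,y_j)$ and $(x_i,y_i)\neq(y_j,x_j)$. Put $g_i(\theta)=x_iy_i\theta^2+(x_i+y_i-1)\theta+1$. If every pair $g_i,g_j$ with $i\neq j$ has a common complex zero and none of the $g_i$ has a double zero, then the ML-degree of the association parameter $\theta$ in GBED($\theta$) for these data is $n+1$.
   Context: GBED($\theta$) is Gumbel's Type-I bivariate exponential distribution with association parameter $\theta\in[0,1]$, with density $e^{-(x+y+\theta xy)}[(1+\theta x)(1+\theta y)-\theta]$ on the first quadrant. For data $(x_i,y_i)$, $i=1,\dots,n$, put $c_i=x_iy_i$, $d_i=x_i+y_i-1$, $$f_i(\theta)=c_i^2\theta^2+c_i(d_i-2)\theta+(c_i-d_i),\qquad g_i(\theta)=c_i\theta^2+d_i\theta+1,$$ $$f(\theta)=\sum_{i=1}^n f_i(\theta)\prod_{j\neq i}g_j(\theta),\qquad g(\theta)=\prod_{i=1}^n g_i(\theta).$$ The score equation is $\sum_{i=1}^n f_i(\theta)/g_i(\theta)=0$, i.e. $f(\theta)/g(\theta)=0$. The ML-degree of $\theta$ for the given data is the number of solutions of the score equation over $\mathbb{C}$ counted with multiplicity, that is, the number of complex zeros of $f$ that are not zeros of $g$, each counted with its multiplicity as a zero of $f$. *)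

theory Defs
  imports Complex_Main "HOL-Computational_Algebra.Polynomial"
begin

definition gbed_density :: "real \<Rightarrow> real \<Rightarrow> real \<Rightarrow> real" where
  "gbed_density \<theta> x y =
     exp (- (x + y + \<theta> * x * y)) * ((1 + \<theta> * x) * (1 + \<theta> * y) - \<theta>)"

definition gbed_loglik :: "nat \<Rightarrow> (nat \<Rightarrow> real) \<Rightarrow> (nat \<Rightarrow> real) \<Rightarrow> real \<Rightarrow> real" where
  "gbed_loglik n x y \<theta> = (\<Sum>i=1..n. ln (gbed_density \<theta> (x i) (y i)))"

text \<open>The polynomials below are in the variable \<open>\<theta>\<close>, over the complex numbers;
  coefficients are listed from the constant term upwards.\<close>

definition score_denom :: "real \<Rightarrow> real \<Rightarrow> complex poly" where
  "score_denom x y = [:1, of_real (x + y - 1), of_real (x * y):]"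

definition score_numer :: "real \<Rightarrow> real \<Rightarrow> complex poly" where
  "score_numer x y =
     (let c = x * y; d = x + y - 1
      in [:of_real (c - d), of_real (c * (d - 2)), of_real (c\<^sup>2):])"

definition score_f :: "nat \<Rightarrow> (nat \<Rightarrow> real) \<Rightarrow> (nat \<Rightarrow> real) \<Rightarrow> complex poly" where
  "score_f n x y =
     (\<Sum>i=1..n. score_numer (x i) (y i) * (\<Prod>j\<in>{1..n} - {i}. score_denom (x j) (y j)))"

definition score_g :: "nat \<Rightarrow> (nat \<Rightarrow> real) \<Rightarrow> (nat \<Rightarrow> real) \<Rightarrow> complex poly" where
  "score_g n x y = (\<Prod>i=1..n. score_denom (x i) (y i))"

text \<open>The sum ranges over a finite set whenever \<open>score_f n x y \<noteq> 0\<close>. For positive data and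
  \<open>n \<ge> 1\<close> this holds, as the coefficient of degree \<open>2 * n\<close> is
  \<open>(\<Prod>i. x i * y i) * (\<Sum>i. x i * y i)\<close>.\<close>

definition ml_degree :: "nat \<Rightarrow> (nat \<Rightarrow> real) \<Rightarrow> (nat \<Rightarrow> real) \<Rightarrow> nat" where
  "ml_degree n x y =
     (\<Sum>z | poly (score_f n x y) z = 0 \<and> poly (score_g n x y) z \<noteq> 0. order z (score_f n x y))"

text \<open>Up to sign, the rational function \<open>\<Sum>i. f\<^sub>i / g\<^sub>i\<close> is the derivative of the log-likelihood.\<close>

lemma gbed_loglik_has_derivative:
  assumes "\<And>i. i \<in> {1..n} \<Longrightarrow> gbed_density \<theta> (x i) (y i) > 0"
  shows "\<exists>D. (gbed_loglik n x y has_real_derivative D) (at \<theta>) \<and>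
     of_real D = - (\<Sum>i=1..n. poly (score_numer (x i) (y i)) (of_real \<theta>)
                             / poly (score_denom (x i) (y i)) (of_real \<theta>))"
proof -
  define G where "G = (\<lambda>a b. (1 + \<theta> * a) * (1 + \<theta> * b) - \<theta> :: real)"
  define E where "E = (\<lambda>a b. a * (1 + \<theta> * b) + b * (1 + \<theta> * a) - 1 :: real)"
  define D where "D = (\<Sum>i=1..n. - (x i * y i) + E (x i) (y i) / G (x i) (y i))"
  have pos: "G (x i) (y i) > 0" if "i \<in> {1..n}" for i
    using assms[OF that] by (simp add: gbed_density_def G_def zero_less_mult_iff)
  have "((\<lambda>t. ln (gbed_density t (x i) (y i))) has_real_derivative
          - (x i * y i) + E (x i) (y i) / G (x i) (y i)) (at \<theta>)" if "i \<in> {1..n}" for i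
  proof -
    have d: "((\<lambda>t. gbed_density t (x i) (y i)) has_real_derivative
        exp (- (x i + y i + \<theta> * x i * y i)) * (- (x i * y i) * G (x i) (y i) + E (x i) (y i))) (at \<theta>)"
      unfolding gbed_density_def G_def E_def
      by (rule derivative_eq_intros refl | simp add: algebra_simps)+
    have dens: "gbed_density \<theta> (x i) (y i) = exp (- (x i + y i + \<theta> * x i * y i)) * G (x i) (y i)"
      by (simp add: gbed_density_def G_def)
    have cancel: "1 / (e * g) * (e * (c * g + k)) = c + k / g" if "e \<noteq> 0" "g \<noteq> 0" for e g c k :: real
      using that by (simp add: field_simps)
    show ?thesis
      by (rule DERIV_cong[OF DERIV_chain2[where f = ln, OF DERIV_ln_divide[OF assms[OF that]] d]],
          unfold dens, rule cancel) (use pos[OF that] in auto)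
  qed
  then have "(gbed_loglik n x y has_real_derivative D) (at \<theta>)"
    unfolding D_def gbed_loglik_def[abs_def] by (intro DERIV_sum) auto
  moreover have "of_real (- (x i * y i) + E (x i) (y i) / G (x i) (y i))
      = - (poly (score_numer (x i) (y i)) (of_real \<theta>)
           / poly (score_denom (x i) (y i)) (of_real \<theta>))" if "i \<in> {1..n}" for i
  proof -
    have den: "poly (score_denom (x i) (y i)) (of_real \<theta>) = of_real (G (x i) (y i))"
      by (simp add: score_denom_def G_def algebra_simps)
    have num: "poly (score_numer (x i) (y i)) (of_real \<theta>)
        = of_real (x i * y i * G (x i) (y i) - E (x i) (y i))"
      by (simp add: score_numer_def G_def E_def Let_def algebra_simps power2_eq_square)
    show ?thesis
      unfolding den num of_real_divide[symmetric] of_real_minus[symmetric] of_real_eq_iff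
      using pos[OF that] by (simp add: field_simps)
  qed
  then have "of_real D = - (\<Sum>i=1..n. poly (score_numer (x i) (y i)) (of_real \<theta>)
                             / poly (score_denom (x i) (y i)) (of_real \<theta>))"
    unfolding D_def of_real_sum sum_negf[symmetric] by (intro sum.cong refl)
  ultimately show ?thesis by blast
qed

end

theory Submission
  imports Defs "HOL-Computational_Algebra.Fundamental_Theorem_Algebra"
begin

text \<open>
  Each numerator satisfies \<open>f\<^sub>i = c\<^sub>i g\<^sub>i - g\<^sub>i'\<close>, so with \<open>C = \<Sum>\<^sub>i c\<^sub>i > 0\<close> the product rule gives
  \<open>f = C g - g'\<close>. A root of \<open>g\<close> of order \<open>k\<close> is a root of \<open>g'\<close>, and hence of \<open>f\<close>, of order \<open>k - 1\<close>.
  Since \<open>deg f = deg g\<close>, subtracting these contributions from the total number of roots of \<open>f\<close>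
  leaves one solution of the score equation for each \<^emph>\<open>distinct\<close> root of \<open>g\<close>. Thus the
  ML-degree is the number of distinct roots of \<open>g\<close>, for arbitrary positive data
  (\<open>ml_degree_eq_card_roots\<close>).

  It remains to count these roots, which is a question about graphs. Under the hypotheses each
  \<open>g\<^sub>i\<close> has exactly two roots, so its root set is an edge on the vertex set \<open>\<complex>\<close>.
  As \<open>g\<^sub>i(0) = 1\<close>, the edge determines \<open>g\<^sub>i\<close>, hence the sum and the product of \<open>x\<^sub>i\<close> and \<open>y\<^sub>i\<close>, hence the
  unordered pair; so the \<open>n\<close> edges are distinct. They meet pairwise, and a
  family of pairwise meeting edges is a star or is contained in a triangle. Because \<open>n \<ge> 4\<close> it is
  a star, and a star with \<open>n\<close> edges has \<open>n + 1\<close> vertices.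
\<close>

section \<open>Roots of a logarithmic derivative shifted by a constant\<close>

lemma sum_order_roots_eq_degree:
  fixes p :: "complex poly"
  assumes "p \<noteq> 0"
  shows "(\<Sum>z | poly p z = 0. order z p) = degree p"
  using size_proots_complex[of p] assms by (simp add: size_multiset_overloaded_eq)

text \<open>The multiple \<open>C g\<close> vanishes at \<open>z\<close> to higher order than \<open>g'\<close>, so it does not affect the
  order of the difference.\<close>

lemma order_smult_diff_pderiv:
  fixes g :: "'a::{idom,semiring_char_0} poly"
  assumes "g \<noteq> 0" "poly g z = 0"
  shows "Suc (order z (smult C g - pderiv g)) = order z g"
proof -
  define m where "m = order z (pderiv g)"
  have ord: "order z g = Suc m"
    using order_pderiv[OF assms] by (simp add: m_def)
  have dg: "pderiv g \<noteq> 0"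
  proof
    assume "pderiv g = 0"
    then have "degree g = 0" by (simp add: pderiv_eq_0_iff)
    then show False using assms by (auto elim!: degree_eq_zeroE)
  qed
  have high: "[:-z, 1:] ^ Suc m dvd smult C g"
    using order_1[of z g] unfolding ord by (rule dvd_smult)
  have "order z (smult C g - pderiv g) = m"
  proof (rule order_unique_lemma)
    have "[:-z, 1:] ^ m dvd smult C g"
      using high power_le_dvd[of "[:-z, 1:]" "Suc m" _ m] by simp
    moreover have "[:-z, 1:] ^ m dvd pderiv g"
      unfolding m_def by (rule order_1)
    ultimately show "[:-z, 1:] ^ m dvd smult C g - pderiv g" by (rule dvd_diff)
    show "\<not> [:-z, 1:] ^ Suc m dvd smult C g - pderiv g"
    proof
      assume "[:-z, 1:] ^ Suc m dvd smult C g - pderiv g"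
      from dvd_diff[OF high this] have "[:-z, 1:] ^ Suc m dvd pderiv g" by simp
      then show False using order_2[OF dg, of z] by (simp add: m_def)
    qed
  qed
  then show ?thesis by (simp add: ord)
qed

text \<open>Away from the roots of \<open>g\<close>, the zeros of \<open>C g - g'\<close> are those of \<open>C - g'/g\<close>, a rational
  function with value \<open>C \<noteq> 0\<close> at infinity and a simple pole at each distinct root of \<open>g\<close>: it has
  as many zeros as poles.\<close>

lemma sum_order_smult_diff_pderiv_nonroots:
  fixes g :: "complex poly"
  assumes "g \<noteq> 0" "C \<noteq> 0"
  shows "(\<Sum>z | poly (smult C g - pderiv g) z = 0 \<and> poly g z \<noteq> 0.
            order z (smult C g - pderiv g)) = card {z. poly g z = 0}"
proof -
  define f where "f = smult C g - pderiv g"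
  let ?N = "{z. poly f z = 0 \<and> poly g z \<noteq> 0}" and ?G = "{z. poly g z = 0}"
  have deg: "degree f = degree g" and f0: "f \<noteq> 0"
  proof -
    have "coeff f (degree g) = C * lead_coeff g"
      by (simp add: f_def coeff_pderiv coeff_eq_0)
    then have lead: "coeff f (degree g) \<noteq> 0" using assms by simp
    then show "f \<noteq> 0" by auto
    have "degree f \<le> degree g"
      unfolding f_def
      by (intro degree_diff_le) (auto simp: degree_pderiv)
    then show "degree f = degree g" using le_degree[OF lead] by (rule le_antisym)
  qed
  have finG: "finite ?G" and finf: "finite {z. poly f z = 0}"
    using assms f0 by (simp_all add: poly_roots_finite)
  have split: "(\<Sum>z | poly f z = 0. order z f) = (\<Sum>z\<in>?N. order z f) + (\<Sum>z\<in>?G. order z f)"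
  proof -
    have "(\<Sum>z | poly f z = 0. order z f) = (\<Sum>z\<in>?N \<union> ?G. order z f)"
      by (rule sum.mono_neutral_left) (use finG finf in \<open>auto simp: order_gt_0_iff[OF f0]\<close>)
    also have "\<dots> = (\<Sum>z\<in>?N. order z f) + (\<Sum>z\<in>?G. order z f)"
      by (rule sum.union_disjoint) (use finG finf in auto)
    finally show ?thesis .
  qed
  have "(\<Sum>z\<in>?N. order z f) + (\<Sum>z\<in>?G. order z f) = (\<Sum>z\<in>?G. order z g)"
    using sum_order_roots_eq_degree[OF f0] sum_order_roots_eq_degree[OF assms(1)] deg split
    by simp
  also have "\<dots> = (\<Sum>z\<in>?G. Suc (order z f))"
    using order_smult_diff_pderiv[OF assms(1)] by (intro sum.cong) (auto simp: f_def)
  also have "\<dots> = card ?G + (\<Sum>z\<in>?G. order z f)"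
    by (simp add: sum_Suc)
  finally show ?thesis by (simp add: f_def)
qed

section \<open>The ML-degree as a number of distinct roots\<close>

lemma score_numer_eq:
  "score_numer x y = smult (of_real (x * y)) (score_denom x y) - pderiv (score_denom x y)"
  by (simp add: score_numer_def score_denom_def Let_def pderiv_pCons power2_eq_square algebra_simps)

lemma score_denom_nonzero [simp]: "score_denom x y \<noteq> 0"
  by (simp add: score_denom_def)

lemma score_f_eq:
  "score_f n x y = smult (of_real (\<Sum>i=1..n. x i * y i)) (score_g n x y) - pderiv (score_g n x y)"
proof -
  have "score_f n x y = (\<Sum>i=1..n.
      smult (of_real (x i * y i))
        (score_denom (x i) (y i) * (\<Prod>j\<in>{1..n} - {i}. score_denom (x j) (y j)))
      - (\<Prod>j\<in>{1..n} - {i}. score_denom (x j) (y j)) * pderiv (score_denom (x i) (y i)))"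
    unfolding score_f_def score_numer_eq by (simp add: algebra_simps)
  also have "\<dots> = (\<Sum>i=1..n. smult (of_real (x i * y i)) (score_g n x y))
      - pderiv (score_g n x y)"
    unfolding sum_subtractf score_g_def pderiv_prod
    by (intro arg_cong2[of _ _ _ _ "(-)"] sum.cong refl arg_cong2[of _ _ _ _ smult]
          prod.remove[symmetric]) auto
  also have "(\<Sum>i=1..n. smult (of_real (x i * y i)) (score_g n x y))
      = smult (of_real (\<Sum>i=1..n. x i * y i)) (score_g n x y)"
    by (simp only: of_real_sum smult_sum)
  finally show ?thesis .
qed

theorem ml_degree_eq_card_roots:
  assumes "n \<ge> 1" and pos: "\<And>i. i \<in> {1..n} \<Longrightarrow> x i > 0 \<and> y i > 0"
  shows "ml_degree n x y = card {z. poly (score_g n x y) z = 0}"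
proof -
  have "(\<Sum>i=1..n. x i * y i) > 0"
    using assms by (intro sum_pos) auto
  then have "complex_of_real (\<Sum>i=1..n. x i * y i) \<noteq> 0"
    by (metis of_real_eq_0_iff less_irrefl)
  moreover have "score_g n x y \<noteq> 0"
    by (simp add: score_g_def)
  ultimately show ?thesis
    unfolding ml_degree_def score_f_eq by (intro sum_order_smult_diff_pderiv_nonroots)
qed

section \<open>Root sets of the quadratic denominators\<close>

lemma card_roots_score_denom:
  assumes "x * y \<noteq> 0" and simple: "\<And>z. order z (score_denom x y) \<noteq> 2"
  shows "card {z. poly (score_denom x y) z = 0} = 2"
proof -
  have deg: "degree (score_denom x y) = 2"
    using assms(1) by (simp add: score_denom_def)
  have "order z (score_denom x y) = 1" if "poly (score_denom x y) z = 0" for z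
  proof -
    have "order z (score_denom x y) > 0"
      using that by (simp add: order_gt_0_iff)
    moreover have "order z (score_denom x y) \<le> 2"
      using order_degree[of "score_denom x y" z] deg by simp
    ultimately show ?thesis using simple[of z] by linarith
  qed
  then have "(\<Sum>z | poly (score_denom x y) z = 0. order z (score_denom x y))
      = card {z. poly (score_denom x y) z = 0}"
    by simp
  then show ?thesis
    using sum_order_roots_eq_degree[of "score_denom x y"] deg by simp
qed

text \<open>By Vieta, two distinct roots \<open>r, s\<close> of \<open>c \<theta>\<^sup>2 + d \<theta> + 1\<close> give \<open>c r s = 1\<close> and
  \<open>d = - c (r + s)\<close>, so they determine \<open>c\<close> and \<open>d\<close>.\<close>

lemma score_denom_roots_inject:
  assumes "card {z. poly (score_denom x y) z = 0} = 2"
    and same: "{z. poly (score_denom x y) z = 0} = {z. poly (score_denom x' y') z = 0}"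
  shows "(x, y) = (x', y') \<or> (x, y) = (y', x')"
proof -
  obtain r s where rs: "{z. poly (score_denom x y) z = 0} = {r, s}" "r \<noteq> s"
    using assms(1) by (auto simp: card_2_iff)
  have vieta: "c * (r * s) = 1 \<and> d = - c * (r + s)"
    if "1 + r * (d + r * c) = 0" "1 + s * (d + s * c) = 0" for c d :: complex
  proof -
    have "(r - s) * (d + c * (r + s)) = 0"
      using that by algebra
    then have d: "d = - c * (r + s)"
      using rs(2) by (simp add: eq_neg_iff_add_eq_0)
    then show ?thesis using that(1) by algebra
  qed
  have roots: "poly (score_denom x y) r = 0" "poly (score_denom x y) s = 0"
    "poly (score_denom x' y') r = 0" "poly (score_denom x' y') s = 0"
    using rs same by auto
  let ?c = "complex_of_real (x * y)" and ?c' = "complex_of_real (x' * y')"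
  let ?d = "complex_of_real (x + y - 1)" and ?d' = "complex_of_real (x' + y' - 1)"
  have 1: "?c * (r * s) = 1" "?d = - ?c * (r + s)"
    using vieta[of ?d ?c] roots(1,2) by (simp_all add: score_denom_def)
  have 2: "?c' * (r * s) = 1" "?d' = - ?c' * (r + s)"
    using vieta[of ?d' ?c'] roots(3,4) by (simp_all add: score_denom_def)
  have "?c = ?c'"
    using 1(1) 2(1) by (metis mult_cancel_right mult_zero_right zero_neq_one)
  then have prod: "x * y = x' * y'" and "?d = ?d'"
    using 1(2) 2(2) by (simp_all only: of_real_eq_iff)
  then have sum: "x + y = x' + y'" by (simp only: of_real_eq_iff)
  have "(x - x') * (x - y') = 0"
    using prod sum by algebra
  then show ?thesis using sum by auto
qed

section \<open>Pairwise meeting edges\<close>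

text \<open>If the edges \<open>{p, q}\<close> and \<open>{p, r}\<close> belong to the family and some edge avoids \<open>p\<close>, then that
  edge is \<open>{q, r}\<close>, and an edge meeting all three sides of this triangle is one of
  them. So four edges force a common vertex.\<close>

lemma pairwise_meeting_edges_common_vertex:
  fixes F :: "'a set set"
  assumes "card F \<ge> 4" and edge: "\<And>A. A \<in> F \<Longrightarrow> card A = 2"
    and meet: "\<And>A B. A \<in> F \<Longrightarrow> B \<in> F \<Longrightarrow> A \<inter> B \<noteq> {}"
  obtains p where "\<And>A. A \<in> F \<Longrightarrow> p \<in> A"
proof -
  have "F \<noteq> {}" using assms(1) by auto
  then obtain A where A: "A \<in> F" by auto
  have "\<not> F \<subseteq> {A}"
  proof
    assume "F \<subseteq> {A}"
    from card_mono[OF _ this] show False using assms(1) by simp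
  qed
  then obtain B where B: "B \<in> F" "B \<noteq> A" by auto
  obtain p where p: "p \<in> A" "p \<in> B" using meet[OF A B(1)] by auto
  have pair: "\<exists>v. v \<noteq> u \<and> D = {u, v}" if "D \<in> F" "u \<in> D" for D u
    using edge[OF that(1)] that(2) by (auto simp: card_2_iff)
  obtain q r where q: "A = {p, q}" "q \<noteq> p" and r: "B = {p, r}" "r \<noteq> p"
    using pair[OF A p(1)] pair[OF B(1) p(2)] by auto
  have qr: "q \<noteq> r" using B(2) q r by auto
  have avoid: "D = {q, r}" if D: "D \<in> F" "p \<notin> D" for D
  proof -
    have "q \<in> D" "r \<in> D"
      using meet[OF D(1) A] meet[OF D(1) B(1)] D(2) q r by auto
    then show ?thesis using pair[OF D(1), of q] qr by auto
  qed
  show ?thesis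
  proof (rule that, rule ccontr)
    fix E assume "E \<in> F" "p \<notin> E"
    then have E: "{q, r} \<in> F" using avoid by metis
    have "F \<subseteq> {A, B, {q, r}}"
    proof
      fix D assume D: "D \<in> F"
      show "D \<in> {A, B, {q, r}}"
      proof (cases "p \<in> D")
        case True
        then obtain v where v: "D = {p, v}" using pair[OF D] by metis
        have "v = q \<or> v = r"
          using meet[OF D E] v q(2) r(2) by auto
        then show ?thesis using v q r by auto
      next
        case False
        then show ?thesis using avoid[OF D] by simp
      qed
    qed
    from card_mono[OF _ this] have "card F \<le> card {A, B, {q, r}}" by simp
    also have "\<dots> \<le> 3" by (auto simp: card_insert_if)
    finally show False using assms(1) by simp
  qed
qed

text \<open>In a star with centre \<open>p\<close>, an edge \<open>{p, q}\<close> corresponds to its other end \<open>q\<close>.\<close>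

lemma card_Union_pairwise_meeting_edges:
  fixes F :: "'a set set"
  assumes "card F \<ge> 4" and edge: "\<And>A. A \<in> F \<Longrightarrow> card A = 2"
    and meet: "\<And>A B. A \<in> F \<Longrightarrow> B \<in> F \<Longrightarrow> A \<inter> B \<noteq> {}"
  shows "card (\<Union>F) = card F + 1"
proof -
  obtain p where p: "\<And>A. A \<in> F \<Longrightarrow> p \<in> A"
    using pairwise_meeting_edges_common_vertex[OF assms] by blast
  define Q where "Q = \<Union>F - {p}"
  have finF: "finite F" and neF: "F \<noteq> {}"
    using assms(1) by (auto intro: card_ge_0_finite)
  have "finite A" if "A \<in> F" for A
    using edge[OF that] by (intro card_ge_0_finite) simp
  then have finQ: "finite Q" using finF by (auto simp: Q_def)
  have pair: "\<exists>v. v \<noteq> u \<and> D = {u, v}" if "D \<in> F" "u \<in> D" for D u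
    using edge[OF that(1)] that(2) by (auto simp: card_2_iff)
  have "F = (\<lambda>q. {p, q}) ` Q"
  proof
    show "F \<subseteq> (\<lambda>q. {p, q}) ` Q"
    proof
      fix D assume D: "D \<in> F"
      then obtain v where "v \<noteq> p" "D = {p, v}" using pair p by metis
      then show "D \<in> (\<lambda>q. {p, q}) ` Q" using D by (auto simp: Q_def)
    qed
    show "(\<lambda>q. {p, q}) ` Q \<subseteq> F"
    proof
      fix D assume "D \<in> (\<lambda>q. {p, q}) ` Q"
      then obtain q A where q: "D = {p, q}" "q \<noteq> p" "q \<in> A" "A \<in> F" by (auto simp: Q_def)
      then have "A = {p, q}" using pair[OF q(4) p[OF q(4)]] by auto
      then show "D \<in> F" using q by simp
    qed
  qed
  moreover have "inj_on (\<lambda>q. {p, q}) Q"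
    by (auto simp: inj_on_def Q_def doubleton_eq_iff)
  ultimately have "card F = card Q" by (simp add: card_image)
  moreover have "\<Union>F = insert p Q" using p neF by (auto simp: Q_def)
  moreover have "p \<notin> Q" by (simp add: Q_def)
  ultimately show ?thesis using finQ by simp
qed

section \<open>Data whose denominators pairwise share a root\<close>

theorem theorem5p1:
  fixes n :: nat and x y :: "nat \<Rightarrow> real"
  assumes "n \<ge> 4"
    and "\<And>i. i \<in> {1..n} \<Longrightarrow> x i > 0 \<and> y i > 0"
    and "\<And>i j. i \<in> {1..n} \<Longrightarrow> j \<in> {1..n} \<Longrightarrow> i \<noteq> j \<Longrightarrow>
           (x i, y i) \<noteq> (x j, y j) \<and> (x i, y i) \<noteq> (y j, x j)"
    and "\<And>i j. i \<in> {1..n} \<Longrightarrow> j \<in> {1..n} \<Longrightarrow> i \<noteq> j \<Longrightarrow>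
           \<exists>z. poly (score_denom (x i) (y i)) z = 0 \<and> poly (score_denom (x j) (y j)) z = 0"
    and "\<And>i. i \<in> {1..n} \<Longrightarrow> \<not> (\<exists>z. order z (score_denom (x i) (y i)) = 2)"
  shows "ml_degree n x y = n + 1"
proof -
  define S where "S i = {z. poly (score_denom (x i) (y i)) z = 0}" for i
  have two: "card (S i) = 2" if "i \<in> {1..n}" for i
    unfolding S_def using assms(2)[OF that] assms(5)[OF that]
    by (intro card_roots_score_denom) auto
  have "inj_on S {1..n}"
  proof (rule inj_onI, rule ccontr)
    fix i j assume ij: "i \<in> {1..n}" "j \<in> {1..n}" "S i = S j" "i \<noteq> j"
    have "(x i, y i) = (x j, y j) \<or> (x i, y i) = (y j, x j)"
      using score_denom_roots_inject two[OF ij(1)] ij(3) unfolding S_def by blast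
    then show False using assms(3)[OF ij(1,2,4)] by blast
  qed
  then have cardF: "card (S ` {1..n}) = n"
    by (simp add: card_image)
  have "card (\<Union>(S ` {1..n})) = card (S ` {1..n}) + 1"
  proof (rule card_Union_pairwise_meeting_edges)
    show "4 \<le> card (S ` {1..n})" using cardF assms(1) by simp
    show "card A = 2" if "A \<in> S ` {1..n}" for A
      using that two by auto
    show "A \<inter> B \<noteq> {}" if AB: "A \<in> S ` {1..n}" "B \<in> S ` {1..n}" for A B
    proof -
      obtain i j where ij: "i \<in> {1..n}" "A = S i" "j \<in> {1..n}" "B = S j" using AB by auto
      show ?thesis
      proof (cases "i = j")
        case True
        then show ?thesis using ij two[OF ij(1)] by auto
      next
        case False
        then show ?thesis using assms(4)[OF ij(1,3)] ij by (auto simp: S_def)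
      qed
    qed
  qed
  moreover have "{z. poly (score_g n x y) z = 0} = \<Union>(S ` {1..n})"
    by (auto simp: score_g_def poly_prod S_def)
  moreover have "ml_degree n x y = card {z. poly (score_g n x y) z = 0}"
    using assms(1,2) by (intro ml_degree_eq_card_roots) auto
  ultimately show ?thesis using cardF by simp
qed

end
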